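(* The triplet $(\overline{\mathbb{IR}},+,\cdot)$ is a real vector space, and the vectors $\mathcal{X}_1=\overline{([0,1],0)}$ and $\mathcal{X}_2=\overline{([1,1],0)}$ form a basis of $\overline{\mathbb{IR}}$. In particular $\dim_{\mathbb{R}}\overline{\mathbb{IR}}=2$.
   Context: $\mathbb{IR}$ is the set of non-empty closed bounded intervals $[a,b]$ of $\mathbb{R}$ with $a\le b$ (degenerate intervals $[a,a]$ are allowed), with addition $[a,b]+[c,d]=[a+c,b+d]$; it is a commutative cancellative semigroup, and $0$ denotes $[0,0]$. For $\alpha>0$, $\alpha[a,b]=[\alpha a,\alpha b]$. $\overline{\mathbb{IR}}$ is the quotient of $\mathbb{IR}\times\mathbb{IR}$ by the equivalence relation $(x,y)\sim(z,t)\iff x+t=y+z$; the class of $(x,y)$ is denoted $\overline{(x,y)}$. It is an abelian group for $\overline{(x,y)}+\overline{(z,t)}=\overline{(x+z,y+t)}$, and the opposite of $\overline{(x,y)}$ is $\overline{(y,x)}$. Every element of $\overline{\mathbb{IR}}$ can be written $\overline{(A,0)}$ or $\overline{(0,A)}$ with $A\in\mathbb{IR}$. The external multiplication $\cdot:\mathbb{R}\times\overline{\mathbb{IR}}\to\overline{\mathbb{IR}}$ is defined, for all $A\in\mathbb{IR}$, by: for $\alpha>0$, $\alpha\cdot\overline{(A,0)}=\overline{(\alpha A,0)}$ and $\alpha\cdot\overline{(0,A)}=\overline{(0,\alpha A)}$; for $\alpha<0$, putting $\beta=-\alpha$, $\alpha\cdot\overline{(A,0)}=\overline{(0,\beta A)}$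 and $\alpha\cdot\overline{(0,A)}=\overline{(\beta A,0)}$; and $0\cdot\mathcal{X}=\overline{(0,0)}$ for all $\mathcal{X}$. *)

theory Defs
  imports Complex_Main "HOL-Library.Interval"
begin

definition interval_rel :: "real interval \<times> real interval \<Rightarrow> real interval \<times> real interval \<Rightarrow> bool"
  where "interval_rel = (\<lambda>(x, y) (z, t). x + t = y + z)"

lemma equivp_interval_rel: "equivp interval_rel"
  by (rule equivpI)
     (auto simp: interval_rel_def reflp_def symp_def transp_def interval_eq_iff)

quotient_type gen_interval = "real interval \<times> real interval" / interval_rel
  by (rule equivp_interval_rel)

lift_definition cls :: "real interval \<Rightarrow> real interval \<Rightarrow> gen_interval" is Pair .

lemma cls_eq_iff: "cls x y = cls z t \<longleftrightarrow> x + t = y + z"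
  by transfer (simp add: interval_rel_def)

lemma cls_cases: obtains x y where "X = cls x y"
proof -
  have "\<exists>x y. X = cls x y"
    by transfer (auto simp: interval_rel_def intro: add.commute)
  then show ?thesis using that by blast
qed

instantiation gen_interval :: ab_group_add
begin

lift_definition zero_gen_interval :: gen_interval is "(0, 0)" .

lift_definition plus_gen_interval :: "gen_interval \<Rightarrow> gen_interval \<Rightarrow> gen_interval"
  is "\<lambda>(x, y) (z, t). (x + z, y + t)"
  by (auto simp: interval_rel_def interval_eq_iff)

lift_definition uminus_gen_interval :: "gen_interval \<Rightarrow> gen_interval"
  is "\<lambda>(x, y). (y, x)"
  by (auto simp: interval_rel_def interval_eq_iff)

definition minus_gen_interval :: "gen_interval \<Rightarrow> gen_interval \<Rightarrow> gen_interval"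
  where "X - Y = X + (- Y)" for X Y :: gen_interval

instance
proof
  fix a b c :: gen_interval
  show "a + b + c = a + (b + c)"
    by transfer (auto simp: interval_rel_def interval_eq_iff)
  show "a + b = b + a"
    by transfer (auto simp: interval_rel_def interval_eq_iff)
  show "0 + a = a"
    by transfer (auto simp: interval_rel_def interval_eq_iff)
  show "- a + a = 0"
    by transfer (auto simp: interval_rel_def interval_eq_iff)
  show "a - b = a + - b"
    by (rule minus_gen_interval_def)
qed

end

lemma zero_gen_interval_eq: "0 = cls 0 0"
  by transfer (simp add: interval_rel_def)

lemma cls_plus: "cls x y + cls z t = cls (x + z) (y + t)"
  by transfer (simp add: interval_rel_def add.commute)

lemma uminus_cls: "- cls x y = cls y x"
  by transfer (simp add: interval_rel_def add.commute)

text \<open>Used only for \<open>\<alpha> > 0\<close>; for \<open>\<alpha> < 0\<close> the pair need not be ordered and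
  \<open>Interval\<close> is then unspecified.\<close>

definition scale_interval :: "real \<Rightarrow> real interval \<Rightarrow> real interval"
  where "scale_interval \<alpha> A = Interval (\<alpha> * lower A, \<alpha> * upper A)"

lemma lower_Interval: "a \<le> b \<Longrightarrow> lower (Interval (a, b)) = a"
  by (simp add: lower.rep_eq Interval_inverse)

lemma upper_Interval: "a \<le> b \<Longrightarrow> upper (Interval (a, b)) = b"
  by (simp add: upper.rep_eq Interval_inverse)

lemma lower_scale_interval: "\<alpha> > 0 \<Longrightarrow> lower (scale_interval \<alpha> A) = \<alpha> * lower A"
  by (simp add: scale_interval_def lower_Interval)

lemma upper_scale_interval: "\<alpha> > 0 \<Longrightarrow> upper (scale_interval \<alpha> A) = \<alpha> * upper A"
  by (simp add: scale_interval_def upper_Interval)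

text \<open>A generalized interval may be of both forms \<open>cls A 0\<close> and \<open>cls 0 B\<close> (when \<open>A\<close> is
  degenerate), and multiplication is prescribed on each form. That these prescriptions agree
  and cover every element is established by \<open>cls_normal_form\<close> and \<open>smult_pos\<close>,
  \<open>smult_neg\<close> below.\<close>

definition smult_graph :: "real \<Rightarrow> gen_interval \<Rightarrow> gen_interval \<Rightarrow> bool"
  where "smult_graph \<alpha> X Y \<longleftrightarrow>
    (\<alpha> > 0 \<and> (\<exists>A. X = cls A 0 \<and> Y = cls (scale_interval \<alpha> A) 0)) \<or>
    (\<alpha> > 0 \<and> (\<exists>A. X = cls 0 A \<and> Y = cls 0 (scale_interval \<alpha> A))) \<or>
    (\<alpha> < 0 \<and> (\<exists>A. X = cls A 0 \<and> Y = cls 0 (scale_interval (- \<alpha>) A))) \<or>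
    (\<alpha> < 0 \<and> (\<exists>A. X = cls 0 A \<and> Y = cls (scale_interval (- \<alpha>) A) 0)) \<or>
    (\<alpha> = 0 \<and> Y = cls 0 0)"

definition smult :: "real \<Rightarrow> gen_interval \<Rightarrow> gen_interval"
  where "smult \<alpha> X = (THE Y. smult_graph \<alpha> X Y)"

lemma cls_normal_form: "\<exists>A. X = cls A 0 \<or> X = cls 0 A"
proof -
  obtain x y where X: "X = cls x y" by (rule cls_cases)
  show ?thesis
  proof (cases "lower x - lower y \<le> upper x - upper y")
    case True
    then have "X = cls (Interval (lower x - lower y, upper x - upper y)) 0"
      by (simp add: X cls_eq_iff interval_eq_iff lower_Interval upper_Interval)
    then show ?thesis by blast
  next
    case False
    then have "X = cls 0 (Interval (lower y - lower x, upper y - upper x))"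
      by (simp add: X cls_eq_iff interval_eq_iff lower_Interval upper_Interval)
    then show ?thesis by blast
  qed
qed

lemma smult_graph_unique: "smult_graph \<alpha> X Y \<Longrightarrow> smult_graph \<alpha> X Z \<Longrightarrow> Y = Z"
  unfolding smult_graph_def
  by (auto simp: cls_eq_iff interval_eq_iff lower_scale_interval upper_scale_interval
      add_eq_0_iff simp flip: distrib_left)

lemma smult_eqI: "smult_graph \<alpha> X Y \<Longrightarrow> smult \<alpha> X = Y"
  unfolding smult_def using smult_graph_unique by blast

lemma smult_pos:
  assumes "\<alpha> > 0"
  shows "smult \<alpha> (cls A 0) = cls (scale_interval \<alpha> A) 0"
    and "smult \<alpha> (cls 0 A) = cls 0 (scale_interval \<alpha> A)"
  by (rule smult_eqI, use assms in \<open>auto simp: smult_graph_def\<close>)+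

lemma smult_neg:
  assumes "\<alpha> < 0"
  shows "smult \<alpha> (cls A 0) = cls 0 (scale_interval (- \<alpha>) A)"
    and "smult \<alpha> (cls 0 A) = cls (scale_interval (- \<alpha>) A) 0"
  by (rule smult_eqI, use assms in \<open>auto simp: smult_graph_def\<close>)+

lemma smult_zero: "smult 0 X = cls 0 0"
  by (rule smult_eqI) (simp add: smult_graph_def)

definition X1 :: gen_interval where "X1 = cls (Interval (0, 1)) 0"

definition X2 :: gen_interval where "X2 = cls (Interval (1, 1)) 0"

end

theory Submission
  imports Defs
begin

text \<open>The class of \<open>(x, y)\<close> is determined by two real numbers, the differences of the lower and
  of the upper endpoints of \<open>x\<close> and \<open>y\<close>: the relation \<open>x + t = y + z\<close> says exactly that these
  differences agree. They are additive, and they are homogeneous for every real scalar, negative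
  ones included, because multiplying by a negative number swaps the two components of the pair
  instead of swapping the endpoints of an interval. So generalized intervals embed in the real
  plane compatibly with both operations (\<open>gen_interval_eq_iff\<close>, \<open>net_lower_smult\<close>,
  \<open>net_upper_smult\<close>), and the vector space axioms are inherited from there. The vectors \<open>X1\<close> and
  \<open>X2\<close> have coordinates \<open>(0, 1)\<close> and \<open>(1, 1)\<close>, a basis of the plane, so the embedding is onto and
  \<open>X1\<close>, \<open>X2\<close> form a basis.\<close>

lift_definition net_lower :: "gen_interval \<Rightarrow> real" is "\<lambda>(x, y). lower x - lower y"
  by (auto simp: interval_rel_def interval_eq_iff)

lift_definition net_upper :: "gen_interval \<Rightarrow> real" is "\<lambda>(x, y). upper x - upper y"
  by (auto simp: interval_rel_def interval_eq_iff)

lemma gen_interval_eq_iff: "X = Y \<longleftrightarrow> net_lower X = net_lower Y \<and> net_upper X = net_upper Y"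
  by transfer (auto simp: interval_rel_def interval_eq_iff)

lemma net_lower_cls: "net_lower (cls x y) = lower x - lower y"
  by transfer simp

lemma net_upper_cls: "net_upper (cls x y) = upper x - upper y"
  by transfer simp

lemma net_lower_add: "net_lower (X + Y) = net_lower X + net_lower Y"
  by transfer auto

lemma net_upper_add: "net_upper (X + Y) = net_upper X + net_upper Y"
  by transfer auto

text \<open>It suffices to check homogeneity on the two normal forms. For \<open>\<alpha> < 0\<close> the factor \<open>- \<alpha>\<close> applied
  to the interval and the exchange of the components each contribute a sign, so no case
  distinction survives in the result.\<close>

lemma net_smult:
  "net_lower (smult \<alpha> X) = \<alpha> * net_lower X \<and> net_upper (smult \<alpha> X) = \<alpha> * net_upper X"
proof -
  obtain A where "X = cls A 0 \<or> X = cls 0 A"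
    using cls_normal_form by blast
  then show ?thesis
    by (cases \<alpha> "0 :: real" rule: linorder_cases)
       (auto simp: smult_zero smult_pos smult_neg net_lower_cls net_upper_cls
          lower_scale_interval upper_scale_interval)
qed

lemmas net_lower_smult = net_smult [THEN conjunct1]
  and net_upper_smult = net_smult [THEN conjunct2]

lemma vector_space_smult: "vector_space smult"
  by unfold_locales
     (simp_all add: gen_interval_eq_iff net_lower_add net_upper_add net_lower_smult
        net_upper_smult algebra_simps)

lemma net_X1: "net_lower X1 = 0" "net_upper X1 = 1"
  by (simp_all add: X1_def net_lower_cls net_upper_cls lower_Interval upper_Interval)

lemma net_X2: "net_lower X2 = 1" "net_upper X2 = 1"
  by (simp_all add: X2_def net_lower_cls net_upper_cls lower_Interval upper_Interval)

text \<open>The coefficients solve \<open>\<alpha> (0, 1) + \<beta> (1, 1) = (l, u)\<close>. When \<open>X\<close> is an ordinary interval, this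
  writes it as a multiple of the unit interval, scaled to the width of \<open>X\<close>, translated to the
  lower endpoint of \<open>X\<close>.\<close>

lemma gen_interval_decomposition:
  "X = smult (net_upper X - net_lower X) X1 + smult (net_lower X) X2"
  by (simp add: gen_interval_eq_iff net_lower_add net_upper_add net_lower_smult
      net_upper_smult net_X1 net_X2)

theorem theorem1:
  shows "vector_space smult \<and>
    (X1 \<noteq> X2 \<and> \<not> module.dependent smult {X1, X2} \<and> module.span smult {X1, X2} = UNIV) \<and>
    vector_space.dim smult UNIV = 2"
proof -
  interpret vector_space smult
    by (rule vector_space_smult)
  have distinct: "X1 \<noteq> X2"
    by (simp add: gen_interval_eq_iff net_X1 net_X2)
  have "X1 \<noteq> smult c X2" for c
    by (auto simp: gen_interval_eq_iff net_lower_smult net_upper_smult net_X1 net_X2)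
  then have "X1 \<notin> span {X2}"
    by (auto simp: span_singleton)
  moreover have "X2 \<noteq> 0"
    using net_lower_add [of 0 0] net_X2 by auto
  ultimately have indep: "independent {X1, X2}"
    by (simp add: independent_insert distinct)
  have "X \<in> span {X1, X2}" for X
    by (subst gen_interval_decomposition) (intro span_add span_scale span_base; simp)
  then have span: "span {X1, X2} = UNIV"
    by auto
  have "dim UNIV = card {X1, X2}"
    by (rule dim_eq_card) (simp_all add: span indep)
  then show ?thesis
    using vector_space_smult distinct indep span by simp
qed

end
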